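(* Let $(P,\preceq)$ be a lattice, let $S=\{x_1,\ldots,x_n\}$ be a finite subset of $P$ with distinct elements such that $x_i\preceq x_j\Rightarrow i\leq j$, and let $f_1,\ldots,f_n:P\to\mathbb{C}$. If $S$ is join closed, then the row-adjusted join matrix $[S]_{f_1,\ldots,f_n}=(f_i(x_i\vee x_j))_{i,j=1}^n$ satisfies $$\det [S]_{f_1,\ldots,f_n}=\prod_{i=1}^n \Psi_{S,f_i}'(x_i)=\prod_{i=1}^n\ \sum_{x_i\preceq x_j}f_i(x_j)\mu_S(x_i,x_j),$$ where each inner sum is over all $x_j\in S$ with $x_i\preceq x_j$.
   Context: $S$ is join closed if $x\vee y\in S$ for all $x,y\in S$. For each $i=1,\ldots,n$ the function $\Psi_{S,f_i}':S\to\mathbb{C}$ is defined inductively (downwards) by $$\Psi_{S,f_i}'(x_k)=f_i(x_k)-\sum_{x_k\prec x_v}\Psi_{S,f_i}'(x_v),$$ the sum being over $x_v\in S$; equivalently, $f_i(x_k)=\sum_{x_k\preceq x_v}\Psi_{S,f_i}'(x_v)$ for all $k$. $\mu_S$ is the Möbius function of the finite poset $(S,\preceq)$. *)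

theory Defs
  imports Complex_Main "Jordan_Normal_Form.Determinant"
begin

definition join_closed :: "'a::lattice set \<Rightarrow> bool" where
  "join_closed S \<longleftrightarrow> (\<forall>x\<in>S. \<forall>y\<in>S. sup x y \<in> S)"

text \<open>
  The function \<open>\<Psi>'\<^bsub>S,f\<^esub>\<close> is meant for finite \<open>S\<close> and arguments in \<open>S\<close>.
  The recursion does not terminate on every infinite \<open>S\<close>, hence the dummy value there.
\<close>

function psi_down :: "'a::order set \<Rightarrow> ('a \<Rightarrow> complex) \<Rightarrow> 'a \<Rightarrow> complex" where
  "psi_down S f x =
     (if finite S then f x - (\<Sum>y\<in>{y\<in>S. x < y}. psi_down S f y) else 0)"
  by pat_completeness auto
termination
  by (relation "measure (\<lambda>(S, f, x). card {y\<in>S. x < y})") (auto intro!: psubset_card_mono)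

declare psi_down.simps [simp del]

lemma psi_down_sum:
  assumes "finite S" "x \<in> S"
  shows "(\<Sum>y\<in>{y\<in>S. x \<le> y}. psi_down S f y) = f x"
proof -
  have "{y\<in>S. x \<le> y} = insert x {y\<in>S. x < y}"
    using assms by (auto simp: order.order_iff_strict)
  then show ?thesis
    using assms by (simp add: psi_down.simps [of S f x])
qed

text \<open>
  The Moebius function of the finite poset \<open>S\<close> with the order induced from the ambient type;
  it is meant for finite \<open>S\<close> and arguments in \<open>S\<close>.
\<close>

function moebius :: "'a::order set \<Rightarrow> 'a \<Rightarrow> 'a \<Rightarrow> int" where
  "moebius S x y =
     (if x = y then 1
      else if finite S \<and> x < y then - (\<Sum>z\<in>{z\<in>S. x \<le> z \<and> z < y}. moebius S x z)
      else 0)"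
  by pat_completeness auto
termination
  by (relation "measure (\<lambda>(S, x, y). card {z\<in>S. z < y})") (auto intro!: psubset_card_mono)

declare moebius.simps [simp del]

text \<open>
  Row and column indices run over \<open>0, \<dots>, n - 1\<close>, following the convention of
  \<^typ>\<open>complex mat\<close>; row \<open>i\<close> uses the function \<open>f i\<close>.
\<close>

definition row_adjusted_join_mat ::
    "nat \<Rightarrow> (nat \<Rightarrow> 'a::lattice) \<Rightarrow> (nat \<Rightarrow> 'a \<Rightarrow> complex) \<Rightarrow> complex mat" where
  "row_adjusted_join_mat n x f = mat n n (\<lambda>(i, j). f i (sup (x i) (x j)))"

end

theory Submission
  imports Defs
begin

text \<open>
  Expanding \<open>f\<^sub>i\<close> at the join, \<open>f\<^sub>i(x\<^sub>i \<squnion> x\<^sub>j)\<close> is the sum of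
  \<open>\<Psi>'\<^bsub>S,f\<^sub>i\<^esub>(x\<^sub>v)\<close> over all \<open>v\<close> with both \<open>x\<^sub>i \<le> x\<^sub>v\<close> and \<open>x\<^sub>j \<le> x\<^sub>v\<close>.  Hence
  the join matrix is the product of an upper triangular matrix with diagonal
  \<open>\<Psi>'\<^bsub>S,f\<^sub>i\<^esub>(x\<^sub>i)\<close> and the transpose of the unitriangular incidence matrix of the order.
  The second equality is Moebius inversion in \<open>S\<close>.
\<close>

text \<open>For \<open>x\<close> below \<open>y\<close>, the recursion makes
  \<open>moebius S x y\<close> cancel the sum over the rest of the interval. This is the delta
  identity that drives the inversion below.\<close>

lemma sum_moebius_interval:
  assumes "finite S" "x \<in> S" "y \<in> S" "x \<le> y"
  shows "(\<Sum>z\<in>{z\<in>S. x \<le> z \<and> z \<le> y}. moebius S x z) = (if x = y then 1 else 0)"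
proof (cases "x = y")
  case True
  then have "{z\<in>S. x \<le> z \<and> z \<le> y} = {x}"
    using assms by auto
  with True show ?thesis
    by (simp add: moebius.simps)
next
  case False
  have "{z\<in>S. x \<le> z \<and> z \<le> y} = insert y {z\<in>S. x \<le> z \<and> z < y}"
    using assms by (auto simp: order.order_iff_strict)
  then show ?thesis
    using assms False by (simp add: moebius.simps [of S x y])
qed

text \<open>Moebius inversion from above: expand each \<open>f y\<close> by
  \<open>psi_down_sum\<close> and swap the sums. The inner sum over the interval from
  \<open>x\<close> to \<open>z\<close> then vanishes unless \<open>z = x\<close>.\<close>

lemma psi_down_moebius:
  assumes "finite S" "x \<in> S"
  shows "psi_down S f x = (\<Sum>y\<in>{y\<in>S. x \<le> y}. f y * of_int (moebius S x y))"
proof -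
  have "(\<Sum>y\<in>{y\<in>S. x \<le> y}. f y * of_int (moebius S x y))
      = (\<Sum>y\<in>{y\<in>S. x \<le> y}. \<Sum>z\<in>{z\<in>S. y \<le> z}. psi_down S f z * of_int (moebius S x y))"
    using assms by (intro sum.cong refl) (simp flip: psi_down_sum [of S _ f] sum_distrib_right)
  \<comment> \<open>Both double sums run over the chains x \<le> y \<le> z in \<open>S\<close>; as
    sums over pairs they differ only by a swap of coordinates.\<close>
  also have "\<dots> = (\<Sum>z\<in>{z\<in>S. x \<le> z}. \<Sum>y\<in>{y\<in>S. x \<le> y \<and> y \<le> z}.
      psi_down S f z * of_int (moebius S x y))"
    using assms(1) by (subst (1 2) sum.Sigma)
      (auto intro!: sum.reindex_bij_witness [where i = prod.swap and j = prod.swap])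
  also have "\<dots> = (\<Sum>z\<in>{z\<in>S. x \<le> z}. if x = z then psi_down S f z else 0)"
  proof (intro sum.cong refl)
    fix z assume "z \<in> {z\<in>S. x \<le> z}"
    then have "(\<Sum>y\<in>{y\<in>S. x \<le> y \<and> y \<le> z}. psi_down S f z * of_int (moebius S x y))
        = psi_down S f z * of_int (if x = z then 1 else 0)"
      using assms by (simp flip: sum_distrib_left of_int_sum add: sum_moebius_interval)
    then show "(\<Sum>y\<in>{y\<in>S. x \<le> y \<and> y \<le> z}. psi_down S f z * of_int (moebius S x y))
        = (if x = z then psi_down S f z else 0)"
      by simp
  qed
  also have "\<dots> = psi_down S f x"
    using assms by simp
  finally show ?thesis ..
qed

text \<open>Passes from sums over elements of \<open>S\<close>, as in \<open>psi_down_sum\<close>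
  and \<open>psi_down_moebius\<close>, to sums over matrix indices.\<close>

lemma sum_image_filter:
  fixes x :: "nat \<Rightarrow> 'a" and g :: "'a \<Rightarrow> 'b::comm_monoid_add"
  assumes "inj_on x {..<n}"
  shows "(\<Sum>y\<in>{y \<in> x ` {..<n}. P y}. g y) = (\<Sum>j\<in>{j. j < n \<and> P (x j)}. g (x j))"
proof -
  have "{y \<in> x ` {..<n}. P y} = x ` {j. j < n \<and> P (x j)}"
    by auto
  moreover have "inj_on x {j. j < n \<and> P (x j)}"
    by (rule inj_on_subset [OF assms]) auto
  ultimately show ?thesis
    by (simp add: sum.reindex)
qed

lemma det_row_adjusted_join_mat:
  fixes x :: "nat \<Rightarrow> 'a::lattice"
  assumes S: "S = x ` {..<n}"
    and inj: "inj_on x {..<n}"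
    and mono: "\<And>i j. i < n \<Longrightarrow> j < n \<Longrightarrow> x i \<le> x j \<Longrightarrow> i \<le> j"
    and join: "join_closed S"
  shows "det (row_adjusted_join_mat n x f) = (\<Prod>i<n. psi_down S (f i) (x i))"
proof -
  \<comment> \<open>Only the row index selects a function, so all dependence on \<open>f\<close>
    sits in the left factor.\<close>
  define A where
    "A = mat n n (\<lambda>(i, v). if x i \<le> x v then psi_down S (f i) (x v) else 0)"
  define B where "B = mat n n (\<lambda>(v, j). if x j \<le> x v then 1 else 0 :: complex)"
  have carrier: "A \<in> carrier_mat n n" "B \<in> carrier_mat n n"
    by (simp_all add: A_def B_def)
  have "row_adjusted_join_mat n x f = A * B"
  proof (rule eq_matI)
    fix i j assume "i < dim_row (A * B)" "j < dim_col (A * B)"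
    then have ij: "i < n" "j < n"
      using carrier by auto
    \<comment> \<open>Join closure enters here: \<open>psi_down_sum\<close> expands
      \<open>f i\<close> only at points of \<open>S\<close>.\<close>
    then have "sup (x i) (x j) \<in> S"
      using join by (simp add: S join_closed_def)
    then have "f i (sup (x i) (x j)) = (\<Sum>y\<in>{y\<in>S. sup (x i) (x j) \<le> y}. psi_down S (f i) y)"
      by (intro psi_down_sum [symmetric]) (simp_all add: S)
    also have "\<dots> = (\<Sum>v\<in>{v. v < n \<and> sup (x i) (x j) \<le> x v}. psi_down S (f i) (x v))"
      unfolding S by (rule sum_image_filter [OF inj])
    \<comment> \<open>The join lies below \<open>x v\<close> iff both \<open>x i\<close> and
      \<open>x j\<close> do, so the condition splits into one indicator for each factor; the added
      terms are zero.\<close>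
    also have "\<dots> = (\<Sum>v\<in>{0..<n}. (if x i \<le> x v then psi_down S (f i) (x v) else 0)
        * (if x j \<le> x v then 1 else 0))"
      by (rule sum.mono_neutral_cong_left) auto
    also have "\<dots> = (A * B) $$ (i, j)"
      using ij by (simp add: A_def B_def scalar_prod_def)
    finally show "row_adjusted_join_mat n x f $$ (i, j) = (A * B) $$ (i, j)"
      using ij by (simp add: row_adjusted_join_mat_def)
  qed (simp_all add: row_adjusted_join_mat_def A_def B_def)
  then have "det (row_adjusted_join_mat n x f) = det A * det B"
    by (simp add: det_mult [OF carrier])
  moreover have "upper_triangular A"
    unfolding upper_triangular_def
  proof (intro allI impI)
    fix i j assume "i < dim_row A" "j < i"
    then show "A $$ (i, j) = 0"
      using mono [of i j] by (auto simp: A_def)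
  qed
  then have "det A = (\<Prod>i<n. psi_down S (f i) (x i))"
    using det_upper_triangular [OF _ carrier(1)]
    by (simp add: prod_list_diag_prod A_def lessThan_atLeast0)
  \<comment> \<open>A nonzero entry would mean x j \<le> x i, hence j \<le> i by
    \<open>mono\<close>. The diagonal of \<open>B\<close> is 1 by reflexivity.\<close>
  moreover have "B $$ (i, j) = 0" if "i < j" "j < n" for i j
    using mono [of j i] that by (auto simp: B_def)
  then have "det B = 1"
    using det_lower_triangular [OF _ carrier(2)]
    by (simp add: prod_list_diag_prod B_def)
  ultimately show ?thesis
    by simp
qed

theorem theorem7p3:
  fixes n :: nat and x :: "nat \<Rightarrow> 'a::lattice" and S :: "'a set"
    and f :: "nat \<Rightarrow> 'a \<Rightarrow> complex"
  assumes "S = x ` {..<n}"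
    and "inj_on x {..<n}"
    and "\<And>i j. i < n \<Longrightarrow> j < n \<Longrightarrow> x i \<le> x j \<Longrightarrow> i \<le> j"
    and "join_closed S"
  shows "det (row_adjusted_join_mat n x f) = (\<Prod>i<n. psi_down S (f i) (x i))
    \<and> (\<Prod>i<n. psi_down S (f i) (x i))
        = (\<Prod>i<n. \<Sum>j\<in>{j. j < n \<and> x i \<le> x j}. f i (x j) * of_int (moebius S (x i) (x j)))"
proof
  show "det (row_adjusted_join_mat n x f) = (\<Prod>i<n. psi_down S (f i) (x i))"
    using assms by (rule det_row_adjusted_join_mat)
  show "(\<Prod>i<n. psi_down S (f i) (x i))
      = (\<Prod>i<n. \<Sum>j\<in>{j. j < n \<and> x i \<le> x j}. f i (x j) * of_int (moebius S (x i) (x j)))"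
  proof (rule prod.cong)
    fix i assume "i \<in> {..<n}"
    then have "psi_down S (f i) (x i)
        = (\<Sum>y\<in>{y \<in> S. x i \<le> y}. f i y * of_int (moebius S (x i) y))"
      using assms(1) by (simp add: psi_down_moebius)
    also have "\<dots> = (\<Sum>j\<in>{j. j < n \<and> x i \<le> x j}. f i (x j) * of_int (moebius S (x i) (x j)))"
      using sum_image_filter [OF assms(2)] assms(1) by fast
    finally show "psi_down S (f i) (x i)
      = (\<Sum>j\<in>{j. j < n \<and> x i \<le> x j}. f i (x j) * of_int (moebius S (x i) (x j)))" .
  qed simp
qed

end
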